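(* Let $k,n_1,n_2,\nu\in\mathbb{Z}_{\ge1}$, $F\in\mathbb{C}^{\nu\times\nu}$, $R_1,\dots,R_k\in\mathbb{C}^{n_1\times n_2}$, and $q_1,\dots,q_k$ polynomials with real coefficients. Define the linear maps $$\mathcal{H}_{\rm p}:\mathbb{C}^{n_2\times\nu}\to\mathbb{C}^{n_1\times\nu},\ \mathcal{H}_{\rm p}(X)=\sum_{i=1}^kR_iXq_i(F),\qquad \mathcal{H}_{\rm d}:\mathbb{C}^{\nu\times n_1}\to\mathbb{C}^{\nu\times n_2},\ \mathcal{H}_{\rm d}(Y)=\sum_{i=1}^kq_i(F)YR_i,$$ and the polynomial matrix $R(\lambda)=\sum_{i=1}^kR_iq_i(\lambda)\in\mathbb{C}^{n_1\times n_2}$. Then: (i) $\mathcal{H}_{\rm p}$ is surjective if and only if $R(\lambda)$ has full row rank for all $\lambda\in\mathrm{eig}(F)$, and $\mathcal{H}_{\rm p}$ is injective if and only if $R(\lambda)$ has full column rank for all $\lambda\in\mathrm{eig}(F)$; (ii) $\mathcal{H}_{\rm d}$ is surjective if and only if $R(\lambda)$ has full column rank for all $\lambda\in\mathrm{eig}(F)$, and $\mathcal{H}_{\rm d}$ is injective if and only if $R(\lambda)$ has full row rank for all $\lambda\in\mathrm{eig}(F)$.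
   Context: $q_i(F)$ denotes substitution of the matrix $F$ into the polynomial $q_i$. *)

theory Defs
  imports "HOL-Analysis.Analysis" "HOL-Computational_Algebra.Polynomial"
begin

text \<open>Scalar multiple of a complex matrix.\<close>
definition smat :: "complex \<Rightarrow> complex^'n^'m \<Rightarrow> complex^'n^'m" where
  "smat c A = (\<chi> a b. c * A $ a $ b)"

text \<open>Matrix power F^j (F^0 = identity).\<close>
definition matpow :: "complex^'n^'n \<Rightarrow> nat \<Rightarrow> complex^'n^'n" where
  "matpow F j = (((**) F) ^^ j) (mat 1)"

text \<open>Substitution of a square complex matrix into a real polynomial: q(F).\<close>
definition poly_mat :: "real poly \<Rightarrow> complex^'n^'n \<Rightarrow> complex^'n^'n" where
  "poly_mat q F = (\<Sum>j\<le>degree q. smat (complex_of_real (coeff q j)) (matpow F j))"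

text \<open>Eigenvalues of a square complex matrix.\<close>
definition eig :: "complex^'n^'n \<Rightarrow> complex set" where
  "eig F = {l. \<exists>v. v \<noteq> 0 \<and> F *v v = l *s v}"

end

theory Submission
  imports Defs "HOL-Computational_Algebra.Fundamental_Theorem_Algebra"
begin

text \<open>
  If the rows of \<open>X\<close> are left eigenvectors of \<open>F\<close> for one eigenvalue \<open>\<lambda>\<close>, i.e.\ \<open>X F = \<lambda> X\<close>,
  then every \<open>q\<^sub>i(F)\<close> acts on \<open>X\<close> as the scalar \<open>q\<^sub>i(\<lambda>)\<close>, so \<open>H\<^sub>p(X) = R(\<lambda>) X\<close>.
  Rank-one matrices \<open>x u\<^sup>T\<close> with \<open>u\<close> a left eigenvector show that an injective \<open>H\<^sub>p\<close> forces
  \<open>R(\<lambda>)\<close> to have trivial kernel. Conversely the kernel of \<open>H\<^sub>p\<close> is invariant under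
  \<open>X \<mapsto> X F\<close>, so if it is nonzero it contains such an \<open>X\<close> (split an annihilating polynomial
  of \<open>F\<close> into linear factors), and a nonzero column of \<open>X\<close> lies in the kernel of \<open>R(\<lambda>)\<close>.
  The map \<open>H\<^sub>d\<close> is \<open>H\<^sub>p\<close> for the transposed data, and under the nondegenerate pairing
  \<open>\<langle>Y, X\<rangle> = tr(Y X)\<close> each of \<open>H\<^sub>p\<close>, \<open>H\<^sub>d\<close> is the adjoint of the other, which turns
  surjectivity of one into injectivity of the other.
\<close>

section \<open>Scalar multiples and matrix polynomials\<close>

lemma smat_mult_left: "smat c (A ** B) = smat c A ** B"
  by (simp add: smat_def matrix_matrix_mult_def vec_eq_iff sum_distrib_left mult.assoc)

lemma smat_mult_right: "smat c (A ** B) = A ** smat c B"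
  by (simp add: smat_def matrix_matrix_mult_def vec_eq_iff sum_distrib_left mult.left_commute)

lemma smat_add_right: "smat c (A + B) = smat c A + smat c B"
  by (simp add: smat_def vec_eq_iff distrib_left)

lemma smat_add_left: "smat (c + d) A = smat c A + smat d A"
  by (simp add: smat_def vec_eq_iff distrib_right)

lemma smat_zero_left [simp]: "smat 0 A = 0"
  and smat_zero_right [simp]: "smat c 0 = 0"
  and smat_one [simp]: "smat 1 A = A"
  by (simp_all add: smat_def vec_eq_iff)

lemma smat_smat: "smat c (smat d A) = smat (c * d) A"
  by (simp add: smat_def vec_eq_iff mult.assoc)

lemma smat_uminus_left: "smat (- c) A = - smat c A"
  by (simp add: smat_def vec_eq_iff)

lemma smat_of_real: "smat (complex_of_real r) A = r *\<^sub>R A"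
  by (simp add: smat_def vec_eq_iff complex_eq_iff)

lemma smat_sum_right: "smat c (sum f S) = (\<Sum>x\<in>S. smat c (f x))"
  by (induction S rule: infinite_finite_induct) (auto simp: smat_add_right)

lemma smat_eq_0_iff: "smat c A = 0 \<longleftrightarrow> c = 0 \<or> A = 0"
  by (auto simp: smat_def vec_eq_iff)

lemma transpose_smat: "transpose (smat c A) = smat c (transpose A)"
  by (simp add: smat_def transpose_def vec_eq_iff)

lemma matrix_add_rdistrib: "(B + C) ** A = B ** A + C ** A"
  by (vector matrix_matrix_mult_def sum.distrib[symmetric] field_simps)

lemma matrix_diff_ldistrib: "(A::'a::comm_ring_1^_^_) ** (B - C) = A ** B - A ** C"
  by (vector matrix_matrix_mult_def sum_subtractf[symmetric] field_simps)

lemma matrix_diff_rdistrib: "(B - C) ** (A::'a::comm_ring_1^_^_) = B ** A - C ** A"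
  by (vector matrix_matrix_mult_def sum_subtractf[symmetric] field_simps)

lemma matrix_sum_left: "sum f S ** (A::'a::comm_semiring_1^_^_) = (\<Sum>x\<in>S. f x ** A)"
  by (induction S rule: infinite_finite_induct) (auto simp: matrix_add_rdistrib)

lemma matrix_sum_right: "(A::'a::comm_semiring_1^_^_) ** sum f S = (\<Sum>x\<in>S. A ** f x)"
  by (induction S rule: infinite_finite_induct) (auto simp: matrix_add_ldistrib)

lemma transpose_add: "transpose (A + B) = transpose A + transpose B"
  by (simp add: transpose_def vec_eq_iff)

lemma transpose_sum: "transpose (sum f S) = (\<Sum>x\<in>S. transpose (f x))"
  by (induction S rule: infinite_finite_induct) (auto simp: transpose_add transpose_def vec_eq_iff)

lemma row_matrix_mult: "(A ** B) $ i = A $ i v* B"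
  by (simp add: vec_eq_iff matrix_matrix_mult_def vector_matrix_mult_def mult.commute)

lemma column_matrix_mult: "column j (A ** B) = A *v column j B"
  by (simp add: vec_eq_iff matrix_matrix_mult_def matrix_vector_mult_def column_def)

text \<open>The complex-coefficient version of \<^const>\<open>poly_mat\<close>, so that polynomials split into linear factors.\<close>

definition cpoly_mat :: "complex poly \<Rightarrow> complex^'n^'n \<Rightarrow> complex^'n^'n" where
  "cpoly_mat p G = (\<Sum>j\<le>degree p. smat (coeff p j) (matpow G j))"

lemma matpow_0 [simp]: "matpow G 0 = mat 1"
  by (simp add: matpow_def)

lemma matpow_Suc: "matpow G (Suc j) = G ** matpow G j"
  by (simp add: matpow_def)

lemma matpow_commute: "matpow G j ** G = G ** matpow G j"
  by (induction j) (simp_all add: matpow_Suc flip: matrix_mul_assoc)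

lemma transpose_matpow: "transpose (matpow G j) = matpow (transpose G) j"
  by (induction j) (simp_all add: matpow_Suc matrix_transpose_mul flip: matpow_commute)

lemma cpoly_mat_eq_sum_lessThan:
  assumes "degree p < N"
  shows "cpoly_mat p G = (\<Sum>j<N. smat (coeff p j) (matpow G j))"
  unfolding cpoly_mat_def using assms
  by (intro sum.mono_neutral_left) (auto simp: coeff_eq_0)

lemma poly_mat_eq_cpoly_mat: "poly_mat q F = cpoly_mat (map_poly complex_of_real q) F"
proof -
  have "degree (map_poly complex_of_real q) < Suc (degree q)"
    by (simp add: degree_map_poly)
  then show ?thesis
    unfolding poly_mat_def
    by (simp add: cpoly_mat_eq_sum_lessThan coeff_map_poly lessThan_Suc_atMost del: sum.lessThan_Suc)
qed

lemma cpoly_mat_0 [simp]: "cpoly_mat 0 G = 0"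
  by (simp add: cpoly_mat_def)

lemma cpoly_mat_add: "cpoly_mat (p + q) G = cpoly_mat p G + cpoly_mat q G"
proof -
  let ?N = "Suc (max (degree p) (degree q))"
  have "degree (p + q) < ?N"
    using degree_add_le_max[of p q] by simp
  then show ?thesis
    by (simp add: cpoly_mat_eq_sum_lessThan[of _ ?N] smat_add_left sum.distrib del: sum.lessThan_Suc)
qed

lemma cpoly_mat_smult: "cpoly_mat (smult a p) G = smat a (cpoly_mat p G)"
  by (simp add: cpoly_mat_eq_sum_lessThan[of _ "Suc (degree p)"] smat_sum_right smat_smat
      del: sum.lessThan_Suc)

lemma cpoly_mat_diff: "cpoly_mat (p - q) G = cpoly_mat p G - cpoly_mat q G"
proof -
  have "cpoly_mat (p + smult (-1) q) G = cpoly_mat p G - cpoly_mat q G"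
    by (simp only: cpoly_mat_add cpoly_mat_smult smat_uminus_left) simp
  then show ?thesis
    by simp
qed

lemma cpoly_mat_pCons: "cpoly_mat (pCons a p) G = smat a (mat 1) + G ** cpoly_mat p G"
proof -
  let ?N = "Suc (degree p)"
  have "degree (pCons a p) < Suc ?N"
    using degree_pCons_le[of a p] by simp
  then have "cpoly_mat (pCons a p) G = (\<Sum>j<Suc ?N. smat (coeff (pCons a p) j) (matpow G j))"
    by (rule cpoly_mat_eq_sum_lessThan)
  also have "\<dots> = smat a (mat 1) + (\<Sum>j<?N. smat (coeff p j) (matpow G (Suc j)))"
    by (subst sum.lessThan_Suc_shift) simp
  also have "(\<Sum>j<?N. smat (coeff p j) (matpow G (Suc j))) = G ** cpoly_mat p G"
    by (simp add: cpoly_mat_eq_sum_lessThan[of p ?N] matrix_sum_right matpow_Suc smat_mult_right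
        del: sum.lessThan_Suc)
  finally show ?thesis .
qed

lemma cpoly_mat_const: "cpoly_mat [:c:] G = smat c (mat 1)"
  by (simp add: cpoly_mat_pCons)

lemma cpoly_mat_mult: "cpoly_mat (p * q) G = cpoly_mat p G ** cpoly_mat q G"
proof (induction p)
  case (pCons a p)
  have "cpoly_mat (pCons a p * q) G = smat a (cpoly_mat q G) + G ** cpoly_mat (p * q) G"
    by (simp add: cpoly_mat_add cpoly_mat_smult cpoly_mat_pCons)
  also have "\<dots> = (smat a (mat 1) + G ** cpoly_mat p G) ** cpoly_mat q G"
    by (simp add: pCons.IH matrix_add_rdistrib matrix_mul_assoc flip: smat_mult_left)
  finally show ?case
    by (simp add: cpoly_mat_pCons)
qed simp

lemma cpoly_mat_monom: "cpoly_mat (monom c n) G = smat c (matpow G n)"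
  by (induction n) (simp_all add: monom_0 monom_Suc cpoly_mat_const cpoly_mat_pCons matpow_Suc
      smat_mult_right)

lemma cpoly_mat_sum: "cpoly_mat (sum f S) G = (\<Sum>x\<in>S. cpoly_mat (f x) G)"
  by (induction S rule: infinite_finite_induct) (auto simp: cpoly_mat_add)

lemma cpoly_mat_commute: "G ** cpoly_mat p G = cpoly_mat p G ** G"
  by (induction p) (simp_all add: cpoly_mat_pCons matrix_add_ldistrib matrix_add_rdistrib
      matrix_mul_assoc flip: smat_mult_left smat_mult_right)

lemma transpose_cpoly_mat: "transpose (cpoly_mat p G) = cpoly_mat p (transpose G)"
  by (simp add: cpoly_mat_def transpose_sum transpose_smat transpose_matpow)

lemma cpoly_mat_left_eigen:
  assumes "X ** G = smat \<mu> X"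
  shows "X ** cpoly_mat p G = smat (poly p \<mu>) X"
proof (induction p)
  case (pCons a p)
  have "X ** cpoly_mat (pCons a p) G = smat a X + (X ** G) ** cpoly_mat p G"
    by (simp add: cpoly_mat_pCons matrix_add_ldistrib matrix_mul_assoc flip: smat_mult_right)
  also have "\<dots> = smat a X + smat \<mu> (X ** cpoly_mat p G)"
    by (simp add: assms flip: smat_mult_left)
  finally show ?case
    by (simp add: pCons.IH smat_smat smat_add_left)
qed simp

section \<open>Eigenmatrices in invariant subspaces\<close>

lemma cpoly_mat_annihilating_poly_exists:
  fixes G :: "complex^'n^'n"
  obtains p where "p \<noteq> 0" "cpoly_mat p G = 0"
proof (cases "inj (matpow G)")
  case False
  then obtain a b where "a \<noteq> b" "matpow G a = matpow G b"
    unfolding inj_def by blast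
  moreover have "monom 1 a - monom 1 b \<noteq> (0 :: complex poly)"
    using \<open>a \<noteq> b\<close> by (metis coeff_0 coeff_diff coeff_monom diff_zero zero_neq_one)
  ultimately show ?thesis
    using that[of "monom 1 a - monom 1 b"] by (simp add: cpoly_mat_diff cpoly_mat_monom)
next
  case inj: True
  then have "dependent (range (matpow G))"
    using independent_bound range_inj_infinite by blast
  then obtain T u where T: "finite T" "T \<subseteq> range (matpow G)" "(\<Sum>v\<in>T. u v *\<^sub>R v) = 0"
    and "\<exists>v\<in>T. u v \<noteq> 0"
    unfolding dependent_explicit by blast
  define J where "J = matpow G -` T"
  have T_eq: "T = matpow G ` J"
    using T(2) by (auto simp: J_def)
  have "finite J"
    unfolding J_def using T(1) inj by (rule finite_vimageI)
  obtain j0 where "j0 \<in> J" "u (matpow G j0) \<noteq> 0"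
    using \<open>\<exists>v\<in>T. u v \<noteq> 0\<close> T_eq by auto
  \<comment> \<open>The vanishing real combination of powers, read as a complex polynomial.\<close>
  define p where "p = (\<Sum>j\<in>J. monom (complex_of_real (u (matpow G j))) j)"
  have "coeff p j0 = complex_of_real (u (matpow G j0))"
    using \<open>finite J\<close> \<open>j0 \<in> J\<close> by (simp add: p_def coeff_sum)
  then have "p \<noteq> 0"
    using \<open>u (matpow G j0) \<noteq> 0\<close> by auto
  moreover have "cpoly_mat p G = (\<Sum>v\<in>T. u v *\<^sub>R v)"
    using inj by (simp add: p_def T_eq cpoly_mat_sum cpoly_mat_monom smat_of_real sum.reindex
        inj_on_subset[OF inj])
  ultimately show ?thesis
    using that T(3) by simp
qed

lemma invariant_set_closed_under_cpoly_mat: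
  assumes "\<And>X Y. X \<in> K \<Longrightarrow> Y \<in> K \<Longrightarrow> X + Y \<in> K"
    and "\<And>c X. X \<in> K \<Longrightarrow> smat c X \<in> K"
    and "\<And>X. X \<in> K \<Longrightarrow> X ** G \<in> K"
    and "X \<in> K"
  shows "X ** cpoly_mat p G \<in> K"
  using \<open>X \<in> K\<close>
proof (induction p arbitrary: X)
  case 0
  then show ?case
    using assms(2)[of X 0] by simp
next
  case (pCons a p)
  have "X ** cpoly_mat (pCons a p) G = smat a X + (X ** G) ** cpoly_mat p G"
    by (simp add: cpoly_mat_pCons matrix_add_ldistrib matrix_mul_assoc flip: smat_mult_right)
  then show ?case
    using pCons assms by simp
qed

lemma left_eigenmatrix_in_invariant_set_if_annihilated:
  fixes G :: "complex^'n^'n" and X :: "complex^'n^'m"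
  assumes add: "\<And>X Y. X \<in> K \<Longrightarrow> Y \<in> K \<Longrightarrow> X + Y \<in> K"
    and scale: "\<And>c X. X \<in> K \<Longrightarrow> smat c X \<in> K"
    and right_mult: "\<And>X. X \<in> K \<Longrightarrow> X ** G \<in> K"
  shows "p \<noteq> 0 \<Longrightarrow> X \<in> K \<Longrightarrow> X \<noteq> 0 \<Longrightarrow> X ** cpoly_mat p G = 0
    \<Longrightarrow> \<exists>Y \<mu>. Y \<in> K \<and> Y \<noteq> 0 \<and> Y ** G = smat \<mu> Y"
\<comment> \<open>Split off linear factors of \<open>p\<close> until the product of the remaining ones no longer
   kills \<open>X\<close>.\<close>
proof (induction "degree p" arbitrary: p X rule: less_induct)
  case (less p X)
  show ?case
  proof (cases "degree p = 0")
    case True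
    then have "X ** cpoly_mat p G = smat (coeff p 0) X"
      by (metis cpoly_mat_const degree_0_id matrix_mul_rid smat_mult_right)
    then show ?thesis
      using less.prems True by (metis leading_coeff_0_iff smat_eq_0_iff)
  next
    case False
    then obtain z where "poly p z = 0"
      by (metis constant_degree fundamental_theorem_of_algebra)
    then obtain r where r: "p = [:-z, 1:] * r"
      by (metis dvdE poly_eq_0_iff_dvd)
    with less.prems(1) have "r \<noteq> 0"
      by auto
    then have "degree r < degree p"
      unfolding r by (subst degree_mult_eq) auto
    define Y where "Y = X ** cpoly_mat r G"
    have "Y \<in> K"
      unfolding Y_def
      by (rule invariant_set_closed_under_cpoly_mat[OF add scale right_mult less.prems(2)])
    show ?thesis
    proof (cases "Y = 0")
      case True
      then show ?thesis
        using less.hyps[OF \<open>degree r < degree p\<close> \<open>r \<noteq> 0\<close> less.prems(2,3)] unfolding Y_def by blast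
    next
      case False
      have "Y ** cpoly_mat [:-z, 1:] G = X ** cpoly_mat p G"
        unfolding Y_def r by (metis cpoly_mat_mult matrix_mul_assoc mult.commute)
      with less.prems(4) have "Y ** cpoly_mat [:-z, 1:] G = 0"
        by simp
      moreover have "cpoly_mat [:-z, 1:] G = G - smat z (mat 1)"
        by (simp add: cpoly_mat_pCons smat_uminus_left)
      ultimately have "Y ** G = smat z Y"
        by (simp add: matrix_diff_ldistrib flip: smat_mult_right)
      then show ?thesis
        using \<open>Y \<in> K\<close> False by blast
    qed
  qed
qed

lemma left_eigenmatrix_in_invariant_set:
  fixes G :: "complex^'n^'n" and X :: "complex^'n^'m"
  assumes "\<And>X Y. X \<in> K \<Longrightarrow> Y \<in> K \<Longrightarrow> X + Y \<in> K"
    and "\<And>c X. X \<in> K \<Longrightarrow> smat c X \<in> K"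
    and "\<And>X. X \<in> K \<Longrightarrow> X ** G \<in> K"
    and "X \<in> K" "X \<noteq> 0"
  obtains Y \<mu> where "Y \<in> K" "Y \<noteq> 0" "Y ** G = smat \<mu> Y"
proof -
  obtain p where "p \<noteq> 0" "cpoly_mat p G = 0"
    by (rule cpoly_mat_annihilating_poly_exists)
  then show ?thesis
    using left_eigenmatrix_in_invariant_set_if_annihilated[OF assms(1-3) _ assms(4,5)] that by fastforce
qed

section \<open>Full rank and eigenvalues\<close>

lemma rank_eq_ncols_iff:
  fixes A :: "'a::field^'n^'m"
  shows "rank A = CARD('n) \<longleftrightarrow> (\<forall>x. A *v x = 0 \<longrightarrow> x = 0)"
proof -
  have "vec.dim (rows A) = CARD('n) \<longleftrightarrow> vec.span (rows A) = UNIV"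
    using vec.dim_eq_full[of "rows A"] by (simp add: vec.dimension_def card_cart_basis)
  then show ?thesis
    unfolding row_rank_def_gen
    by (simp flip: matrix_left_invertible_span_rows_gen matrix_left_invertible_ker)
qed

lemma axis_vector_matrix_mult: "axis i (1::'a::comm_semiring_1) v* A = row i A"
  by (simp add: vec_eq_iff vector_matrix_mult_def axis_def row_def if_distrib if_distribR
      cong del: if_weak_cong)

lemma vector_matrix_mult_eq_sum_rows: "y v* A = (\<Sum>i\<in>UNIV. y $ i *s row i A)"
  by (simp add: vec_eq_iff vector_matrix_mult_def row_def sum_component mult.commute)

lemma rank_eq_nrows_iff:
  fixes A :: "'a::field^'n^'m"
  shows "rank A = CARD('m) \<longleftrightarrow> (\<forall>y. y v* A = 0 \<longrightarrow> y = 0)"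
proof
  assume rank: "rank A = CARD('m)"
  show "\<forall>y. y v* A = 0 \<longrightarrow> y = 0"
  proof (intro allI impI, rule ccontr)
    fix y :: "'a^'m"
    assume "y v* A = 0" "y \<noteq> 0"
    then obtain i where "y $ i \<noteq> 0"
      by (auto simp: vec_eq_iff)
    \<comment> \<open>Row \<open>i\<close> is a combination of the other rows, so fewer than \<open>CARD('m)\<close> rows span.\<close>
    let ?others = "(\<lambda>j. row j A) ` (- {i})"
    have "y $ i *s row i A + (\<Sum>j\<in>- {i}. y $ j *s row j A) = 0"
      using \<open>y v* A = 0\<close> by (simp add: vector_matrix_mult_eq_sum_rows sum.remove[of UNIV i]
          Compl_eq_Diff_UNIV)
    then have "row i A = (- inverse (y $ i)) *s (\<Sum>j\<in>- {i}. y $ j *s row j A)"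
      using \<open>y $ i \<noteq> 0\<close> by (simp add: vec_eq_iff eq_neg_iff_add_eq_0 field_simps)
    then have "row i A \<in> vec.span ?others"
      by (metis (mono_tags, lifting) image_eqI vec.span_base vec.span_scale vec.span_sum)
    then have "rows A \<subseteq> vec.span ?others"
      by (auto simp: rows_def intro: vec.span_base)
    then have "rank A \<le> card ?others"
      unfolding row_rank_def_gen by (simp add: vec.dim_le_card)
    also have "\<dots> \<le> card (- {i})"
      by (rule card_image_le) simp
    also have "\<dots> < CARD('m)"
      by (simp add: Compl_eq_Diff_UNIV card_Diff_singleton)
    finally show False
      using rank by simp
  qed
next
  assume "\<forall>y. y v* A = 0 \<longrightarrow> y = 0"
  then have "inj ((*v) (transpose A))"
    by (simp add: vec.inj_iff_eq_0)
  have "rows A = (*v) (transpose A) ` cart_basis"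
    by (force simp: rows_def cart_basis_def axis_vector_matrix_mult)
  moreover have "vec.span ((*v) (transpose A) ` cart_basis) = range ((*v) (transpose A))"
    by (simp only: vec.span_image span_cart_basis)
  ultimately have "vec.span (rows A) = range ((*v) (transpose A))"
    by simp
  then have "rank A = vec.dim (range ((*v) (transpose A)))"
    unfolding row_rank_def_gen by (metis vec.dim_span)
  also have "\<dots> = vec.dim (UNIV :: ('a^'m) set)"
    using \<open>inj ((*v) (transpose A))\<close> by (intro vec.dim_image_eq) (auto intro: inj_on_subset)
  also have "\<dots> = CARD('m)"
    by (rule vec_dim_card)
  finally show "rank A = CARD('m)" .
qed

lemma rank_transpose_eq_nrows_iff:
  fixes A :: "'a::field^'n^'m"
  shows "rank (transpose A) = CARD('m) \<longleftrightarrow> rank A = CARD('m)"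
  by (simp add: rank_eq_ncols_iff rank_eq_nrows_iff)

lemma square_matrix_kernel_nontrivial_iff:
  fixes A :: "'a::field^'n^'n"
  shows "(\<exists>x. x \<noteq> 0 \<and> A *v x = 0) \<longleftrightarrow> (\<exists>y. y \<noteq> 0 \<and> y v* A = 0)"
proof -
  have "(\<forall>x. A *v x = 0 \<longrightarrow> x = 0) \<longleftrightarrow> (\<exists>B. B ** A = mat 1)"
    by (simp add: matrix_left_invertible_ker)
  also have "\<dots> \<longleftrightarrow> (\<exists>B. B ** transpose A = mat 1)"
    by (simp add: left_invertible_transpose matrix_left_right_inverse)
  also have "\<dots> \<longleftrightarrow> (\<forall>y. y v* A = 0 \<longrightarrow> y = 0)"
    by (simp add: matrix_left_invertible_ker)
  finally show ?thesis
    by auto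
qed

lemma mat_matrix_vector_mult: "mat l *v v = l *s (v::'a::comm_semiring_1^'n)"
  by (simp add: vec_eq_iff matrix_vector_mult_def mat_def if_distrib if_distribR
      cong del: if_weak_cong)

lemma vector_matrix_mult_mat: "v v* mat l = l *s (v::'a::comm_semiring_1^'n)"
  by (simp add: vec_eq_iff vector_matrix_mult_def mat_def if_distrib if_distribR mult.commute
      cong del: if_weak_cong)

lemma eig_iff_left_eigenvector: "l \<in> eig F \<longleftrightarrow> (\<exists>u. u \<noteq> 0 \<and> u v* F = l *s u)"
proof -
  have "(F - mat l) *v v = F *v v - l *s v" for v
    by (simp add: matrix_vector_mult_diff_rdistrib mat_matrix_vector_mult)
  moreover have "u v* (F - mat l) = u v* F - l *s u" for u
    by (simp add: vector_matrix_mult_diff_rdistrib vector_matrix_mult_mat)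
  ultimately show ?thesis
    unfolding eig_def using square_matrix_kernel_nontrivial_iff[of "F - mat l"] by simp
qed

lemma eig_transpose [simp]: "eig (transpose F) = eig F"
  by (simp add: set_eq_iff eig_iff_left_eigenvector[of _ F]) (simp add: eig_def)

lemma eig_if_left_eigenmatrix:
  assumes "X ** F = smat \<mu> X" "X \<noteq> 0"
  shows "\<mu> \<in> eig F"
proof -
  obtain i where "X $ i \<noteq> 0"
    using \<open>X \<noteq> 0\<close> by (auto simp: vec_eq_iff)
  moreover have "X $ i v* F = \<mu> *s X $ i"
    using row_matrix_mult[of X F i] assms(1) by (simp add: smat_def vec_eq_iff)
  ultimately show ?thesis
    unfolding eig_iff_left_eigenvector by blast
qed

section \<open>The trace pairing\<close>

lemma trace_zero [simp]: "trace 0 = 0"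
  by (simp add: trace_def)

lemma trace_sum: "trace (sum f S) = (\<Sum>x\<in>S. trace (f x :: 'a::comm_semiring_1^'n^'n))"
  by (induction S rule: infinite_finite_induct) (auto simp: trace_add)

lemma trace_mult_smat_right: "trace (Y ** smat c Z) = c * trace (Y ** Z)"
  by (simp add: trace_def smat_def matrix_matrix_mult_def sum_distrib_left mult.left_commute)

definition cnj_transpose :: "complex^'n^'m \<Rightarrow> complex^'m^'n" where
  "cnj_transpose A = (\<chi> i j. cnj (A $ j $ i))"

lemma cnj_transpose_cnj_transpose [simp]: "cnj_transpose (cnj_transpose A) = A"
  by (simp add: cnj_transpose_def vec_eq_iff)

lemma cnj_transpose_eq_0_iff [simp]: "cnj_transpose A = 0 \<longleftrightarrow> A = 0"
  by (auto simp: cnj_transpose_def vec_eq_iff)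

lemma inner_eq_Re_trace:
  fixes A B :: "complex^'n^'m"
  shows "inner A B = Re (trace (cnj_transpose A ** B))"
  unfolding trace_def matrix_matrix_mult_def inner_vec_def cnj_transpose_def
  by (simp add: inner_complex_def Re_sum sum.swap[of _ "UNIV :: 'n set"])

lemma trace_pairing_nondegenerate:
  fixes Y :: "complex^'n^'m"
  assumes "\<And>Z. trace (Y ** Z) = 0"
  shows "Y = 0"
proof -
  have "inner (cnj_transpose Y) (cnj_transpose Y) = 0"
    by (simp add: inner_eq_Re_trace assms)
  then show ?thesis
    by simp
qed

lemma surj_iff_inj_trace_adjoint:
  fixes L :: "complex^'a^'b \<Rightarrow> complex^'c^'d" and M :: "complex^'d^'c \<Rightarrow> complex^'b^'a"
  assumes L_add: "\<And>x y. L (x + y) = L x + L y"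
    and L_smat: "\<And>c x. L (smat c x) = smat c (L x)"
    and adjoint: "\<And>x y. trace (M y ** x) = trace (y ** L x)"
  shows "surj L \<longleftrightarrow> inj M"
proof
  assume "surj L"
  show "inj M"
  proof (rule injI)
    fix y1 y2
    assume "M y1 = M y2"
    have "trace ((y1 - y2) ** Z) = 0" for Z
    proof -
      obtain x where "Z = L x"
        using \<open>surj L\<close> by (metis surjD)
      then show ?thesis
        by (simp add: matrix_diff_rdistrib trace_sub flip: adjoint \<open>M y1 = M y2\<close>)
    qed
    then have "y1 - y2 = 0"
      by (rule trace_pairing_nondegenerate)
    then show "y1 = y2"
      by simp
  qed
next
  assume "inj M"
  show "surj L"
  proof (rule ccontr)
    assume "\<not> surj L"
    have "subspace (range L)"
    proof (rule subspaceI)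
      have "L 0 = 0"
        using L_add[of 0 0] by simp
      then show "0 \<in> range L"
        by (metis rangeI)
      show "x + y \<in> range L" if "x \<in> range L" "y \<in> range L" for x y
        using that L_add by (auto intro: range_eqI[where x = "_ + _"])
      show "r *\<^sub>R x \<in> range L" if x: "x \<in> range L" for r x
      proof -
        obtain z where "x = L z"
          using x by blast
        then have "r *\<^sub>R x = L (r *\<^sub>R z)"
          using L_smat[of "complex_of_real r" z] by (simp add: smat_of_real)
        then show ?thesis
          by simp
      qed
    qed
    then have "span (range L) = range L"
      by (rule span_eq_iff[THEN iffD2])
    then have "span (range L) \<subset> span UNIV"
      using \<open>\<not> surj L\<close> by (simp add: psubset_eq del: span_eq_iff)
    then obtain Z0 where "Z0 \<noteq> 0" and orth: "\<And>y. y \<in> span (range L) \<Longrightarrow> orthogonal Z0 y"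
      by (rule orthogonal_to_subspace_exists_gen) (rule that)
    define Y where "Y = cnj_transpose Z0"
    \<comment> \<open>Orthogonality kills the real part of \<open>trace (Y ** L x)\<close>; applied to \<open>L (\<i> x)\<close> it kills
       the imaginary part.\<close>
    have Re_0: "Re (trace (Y ** L x)) = 0" for x
      using orth[of "L x"] by (simp add: Y_def span_base orthogonal_def inner_eq_Re_trace)
    have "trace (M Y ** x) = 0" for x
      using Re_0[of x] Re_0[of "smat \<i> x"]
      by (simp add: adjoint L_smat trace_mult_smat_right complex_eq_iff)
    then have "M Y = 0"
      by (rule trace_pairing_nondegenerate)
    moreover have "M 0 = 0"
      using adjoint[where y = 0] by (intro trace_pairing_nondegenerate) simp
    ultimately have "Y = 0"
      using \<open>inj M\<close> by (metis injD)
    then show False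
      using \<open>Z0 \<noteq> 0\<close> by (simp add: Y_def)
  qed
qed

section \<open>Sandwich operators\<close>

lemma inj_iff_eq_0_if_additive:
  fixes f :: "'a::ab_group_add \<Rightarrow> 'b::ab_group_add"
  assumes "\<And>x y. f (x + y) = f x + f y"
  shows "inj f \<longleftrightarrow> (\<forall>x. f x = 0 \<longrightarrow> x = 0)"
proof -
  interpret additive f
    by unfold_locales (rule assms)
  show ?thesis
  proof
    assume "inj f"
    then show "\<forall>x. f x = 0 \<longrightarrow> x = 0"
      using zero by (metis injD)
  next
    assume kernel: "\<forall>x. f x = 0 \<longrightarrow> x = 0"
    show "inj f"
    proof (rule injI)
      fix x y
      assume "f x = f y"
      then have "f (x - y) = 0"
        by (simp add: diff)
      then have "x - y = 0"
        using kernel by blast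
      then show "x = y"
        by simp
    qed
  qed
qed

definition outer_prod :: "'a::times^'m \<Rightarrow> 'a^'n \<Rightarrow> 'a^'n^'m" where
  "outer_prod x u = (\<chi> i j. x $ i * u $ j)"

lemma matrix_mult_outer_prod: "A ** outer_prod x u = outer_prod (A *v x) u"
  by (simp add: outer_prod_def vec_eq_iff matrix_matrix_mult_def matrix_vector_mult_def
      sum_distrib_right mult.assoc)

lemma outer_prod_matrix_mult: "outer_prod x u ** B = outer_prod x (u v* B)"
  by (simp add: outer_prod_def vec_eq_iff matrix_matrix_mult_def vector_matrix_mult_def
      sum_distrib_left mult.assoc mult.left_commute mult.commute)

lemma outer_prod_eq_0_iff: "outer_prod x (u::'a::semiring_no_zero_divisors^'n) = 0 \<longleftrightarrow> x = 0 \<or> u = 0"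
  by (auto simp: outer_prod_def vec_eq_iff)

lemma outer_prod_scale_right: "outer_prod x (c *s u) = smat c (outer_prod x u)"
  by (simp add: outer_prod_def smat_def vec_eq_iff mult.left_commute)

lemma sandwich_add:
  "(\<Sum>i\<in>I. R i ** (X + Y) ** P i) = (\<Sum>i\<in>I. R i ** X ** P i) + (\<Sum>i\<in>I. R i ** Y ** P i)"
  by (simp add: matrix_add_ldistrib matrix_add_rdistrib sum.distrib)

lemma sandwich_smat: "(\<Sum>i\<in>I. R i ** smat c X ** P i) = smat c (\<Sum>i\<in>I. R i ** X ** P i)"
  by (simp add: smat_sum_right flip: smat_mult_left smat_mult_right)

lemma trace_sandwich_adjoint:
  fixes X :: "'a::comm_semiring_1^'c^'b"
  shows "trace ((\<Sum>i\<in>I. P i ** Y ** R i) ** X) = trace (Y ** (\<Sum>i\<in>I. R i ** X ** P i))"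
proof -
  have "trace ((P i ** Y ** R i) ** X) = trace (Y ** (R i ** X ** P i))" for i
  proof -
    have "trace ((P i ** Y ** R i) ** X) = trace (P i ** (Y ** R i ** X))"
      by (simp add: matrix_mul_assoc)
    also have "\<dots> = trace ((Y ** R i ** X) ** P i)"
      by (rule trace_mul_sym)
    finally show ?thesis
      by (simp add: matrix_mul_assoc)
  qed
  then show ?thesis
    by (simp add: matrix_sum_left matrix_sum_right trace_sum)
qed

lemma surj_sandwich_iff_inj_dual_sandwich:
  fixes R :: "'i \<Rightarrow> complex^'b^'a" and P :: "'i \<Rightarrow> complex^'d^'c"
  shows "surj (\<lambda>X::complex^'c^'b. \<Sum>i\<in>I. R i ** X ** P i)
     \<longleftrightarrow> inj (\<lambda>Y::complex^'a^'d. \<Sum>i\<in>I. P i ** Y ** R i)"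
  by (rule surj_iff_inj_trace_adjoint) (simp_all add: sandwich_add sandwich_smat trace_sandwich_adjoint)

lemma poly_sandwich_left_eigen:
  assumes "X ** F = smat \<mu> X"
  shows "(\<Sum>i\<in>I. R i ** X ** cpoly_mat (p i) F) = (\<Sum>i\<in>I. smat (poly (p i) \<mu>) (R i)) ** X"
  by (simp add: cpoly_mat_left_eigen[OF assms] matrix_sum_left
      flip: matrix_mul_assoc smat_mult_left smat_mult_right)

lemma full_column_rank_if_inj_poly_sandwich:
  fixes F :: "complex^'nu^'nu" and R :: "'i \<Rightarrow> complex^'n2^'n1" and p :: "'i \<Rightarrow> complex poly"
  assumes "inj (\<lambda>X::complex^'nu^'n2. \<Sum>i\<in>I. R i ** X ** cpoly_mat (p i) F)" (is "inj ?H")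
    and "l \<in> eig F"
  shows "rank (\<Sum>i\<in>I. smat (poly (p i) l) (R i)) = CARD('n2)" (is "rank ?R = _")
  unfolding rank_eq_ncols_iff
proof (intro allI impI)
  fix x
  assume "?R *v x = 0"
  obtain u where "u \<noteq> 0" "u v* F = l *s u"
    using \<open>l \<in> eig F\<close> unfolding eig_iff_left_eigenvector by blast
  then have "outer_prod x u ** F = smat l (outer_prod x u)"
    by (simp add: outer_prod_matrix_mult outer_prod_scale_right)
  then have "?H (outer_prod x u) = ?R ** outer_prod x u"
    by (rule poly_sandwich_left_eigen)
  also have "\<dots> = ?H 0"
    by (simp add: matrix_mult_outer_prod \<open>?R *v x = 0\<close> outer_prod_eq_0_iff)
  finally have "outer_prod x u = 0"
    by (rule injD[OF assms(1)])
  then show "x = 0"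
    using \<open>u \<noteq> 0\<close> by (simp add: outer_prod_eq_0_iff)
qed

lemma inj_poly_sandwich_if_full_column_rank:
  fixes F :: "complex^'nu^'nu" and R :: "'i \<Rightarrow> complex^'n2^'n1" and p :: "'i \<Rightarrow> complex poly"
  assumes full_rank: "\<forall>l\<in>eig F. rank (\<Sum>i\<in>I. smat (poly (p i) l) (R i)) = CARD('n2)"
  shows "inj (\<lambda>X::complex^'nu^'n2. \<Sum>i\<in>I. R i ** X ** cpoly_mat (p i) F)" (is "inj ?H")
proof -
  let ?R = "\<lambda>l. \<Sum>i\<in>I. smat (poly (p i) l) (R i)"
  have H_add: "?H (X + Y) = ?H X + ?H Y" for X Y
    by (rule sandwich_add)
  have "X = 0" if "?H X = 0" for X
  proof (rule ccontr)
    assume "X \<noteq> 0"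
    let ?K = "{Z. ?H Z = 0}"
    \<comment> \<open>\<open>?K\<close> is invariant under right multiplication by \<open>F\<close>, which commutes with every
       \<open>cpoly_mat (p i) F\<close>.\<close>
    have H_mult: "?H (Z ** F) = ?H Z ** F" for Z
      by (simp add: matrix_sum_left cpoly_mat_commute flip: matrix_mul_assoc)
    have H_smat: "?H (smat c Z) = smat c (?H Z)" for c Z
      by (rule sandwich_smat)
    obtain Y \<mu> where "Y \<in> ?K" "Y \<noteq> 0" "Y ** F = smat \<mu> Y"
      by (rule left_eigenmatrix_in_invariant_set[of ?K F X])
        (simp_all add: H_add H_mult H_smat \<open>?H X = 0\<close> \<open>X \<noteq> 0\<close>)
    then have "rank (?R \<mu>) = CARD('n2)"
      using full_rank eig_if_left_eigenmatrix by blast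
    obtain j where "column j Y \<noteq> 0"
      using \<open>Y \<noteq> 0\<close> by (auto simp: column_def vec_eq_iff)
    moreover have "?R \<mu> ** Y = 0"
      using poly_sandwich_left_eigen[OF \<open>Y ** F = smat \<mu> Y\<close>, of R p I] \<open>Y \<in> ?K\<close> by simp
    then have "?R \<mu> *v column j Y = 0"
      using column_matrix_mult[of j "?R \<mu>" Y] by (simp add: column_def vec_eq_iff)
    ultimately show False
      using \<open>rank (?R \<mu>) = CARD('n2)\<close> rank_eq_ncols_iff by blast
  qed
  then show "inj ?H"
    using inj_iff_eq_0_if_additive[of ?H] H_add by blast
qed

lemma inj_poly_sandwich_iff:
  fixes F :: "complex^'nu^'nu" and R :: "'i \<Rightarrow> complex^'n2^'n1" and p :: "'i \<Rightarrow> complex poly"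
  shows "inj (\<lambda>X::complex^'nu^'n2. \<Sum>i\<in>I. R i ** X ** cpoly_mat (p i) F)
     \<longleftrightarrow> (\<forall>l\<in>eig F. rank (\<Sum>i\<in>I. smat (poly (p i) l) (R i)) = CARD('n2))"
  using full_column_rank_if_inj_poly_sandwich inj_poly_sandwich_if_full_column_rank by blast

lemma inj_transpose_conjugate_iff: "inj (\<lambda>Y. transpose (H (transpose Y))) \<longleftrightarrow> inj H"
proof
  assume inj: "inj (\<lambda>Y. transpose (H (transpose Y)))"
  show "inj H"
  proof (rule injI)
    fix Z1 Z2
    assume "H Z1 = H Z2"
    then have "transpose (H (transpose (transpose Z1))) = transpose (H (transpose (transpose Z2)))"
      by simp
    then show "Z1 = Z2"
      using injD[OF inj] by fastforce
  qed
qed (auto intro!: injI dest: injD)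

lemma inj_poly_dual_sandwich_iff:
  fixes F :: "complex^'nu^'nu" and R :: "'i \<Rightarrow> complex^'n2^'n1" and p :: "'i \<Rightarrow> complex poly"
  shows "inj (\<lambda>Y::complex^'n1^'nu. \<Sum>i\<in>I. cpoly_mat (p i) F ** Y ** R i)
     \<longleftrightarrow> (\<forall>l\<in>eig F. rank (\<Sum>i\<in>I. smat (poly (p i) l) (R i)) = CARD('n1))"
proof -
  let ?H = "\<lambda>Z. \<Sum>i\<in>I. transpose (R i) ** Z ** cpoly_mat (p i) (transpose F)"
  have "(\<lambda>Y. \<Sum>i\<in>I. cpoly_mat (p i) F ** Y ** R i) = (\<lambda>Y. transpose (?H (transpose Y)))"
    by (simp add: fun_eq_iff transpose_sum matrix_transpose_mul transpose_cpoly_mat matrix_mul_assoc)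
  then have "inj (\<lambda>Y::complex^'n1^'nu. \<Sum>i\<in>I. cpoly_mat (p i) F ** Y ** R i) \<longleftrightarrow> inj ?H"
    using inj_transpose_conjugate_iff[of ?H] by simp
  also have "\<dots> \<longleftrightarrow> (\<forall>l\<in>eig F. rank (\<Sum>i\<in>I. smat (poly (p i) l) (transpose (R i))) = CARD('n1))"
    using inj_poly_sandwich_iff[where R = "\<lambda>i. transpose (R i)" and F = "transpose F"] by simp
  also have "\<dots> \<longleftrightarrow> (\<forall>l\<in>eig F. rank (\<Sum>i\<in>I. smat (poly (p i) l) (R i)) = CARD('n1))"
    by (simp add: rank_transpose_eq_nrows_iff flip: transpose_smat transpose_sum)
  finally show ?thesis .
qed

theorem theoremA:
  fixes k :: nat
    and F :: "complex^'nu^'nu"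
    and R :: "nat \<Rightarrow> complex^'n2^'n1"
    and q :: "nat \<Rightarrow> real poly"
    and Hp :: "complex^'nu^'n2 \<Rightarrow> complex^'nu^'n1"
    and Hd :: "complex^'n1^'nu \<Rightarrow> complex^'n2^'nu"
    and Rl :: "complex \<Rightarrow> complex^'n2^'n1"
  assumes "k \<ge> 1"
    and Hp_eq: "\<And>X. Hp X = (\<Sum>i=1..k. R i ** X ** poly_mat (q i) F)"
    and Hd_eq: "\<And>Y. Hd Y = (\<Sum>i=1..k. poly_mat (q i) F ** Y ** R i)"
    and Rl_eq: "\<And>l. Rl l = (\<Sum>i=1..k. smat (poly (map_poly complex_of_real (q i)) l) (R i))"
  shows "(surj Hp \<longleftrightarrow> (\<forall>l\<in>eig F. rank (Rl l) = CARD('n1)))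
       \<and> (inj Hp \<longleftrightarrow> (\<forall>l\<in>eig F. rank (Rl l) = CARD('n2)))
       \<and> (surj Hd \<longleftrightarrow> (\<forall>l\<in>eig F. rank (Rl l) = CARD('n2)))
       \<and> (inj Hd \<longleftrightarrow> (\<forall>l\<in>eig F. rank (Rl l) = CARD('n1)))"
proof -
  define p where "p i = map_poly complex_of_real (q i)" for i
  have Hp: "Hp = (\<lambda>X. \<Sum>i\<in>{1..k}. R i ** X ** cpoly_mat (p i) F)"
    by (simp add: fun_eq_iff Hp_eq p_def poly_mat_eq_cpoly_mat)
  have Hd: "Hd = (\<lambda>Y. \<Sum>i\<in>{1..k}. cpoly_mat (p i) F ** Y ** R i)"
    by (simp add: fun_eq_iff Hd_eq p_def poly_mat_eq_cpoly_mat)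
  have Rl: "Rl = (\<lambda>l. \<Sum>i\<in>{1..k}. smat (poly (p i) l) (R i))"
    by (simp add: fun_eq_iff Rl_eq p_def)
  have "surj Hp \<longleftrightarrow> inj Hd" "surj Hd \<longleftrightarrow> inj Hp"
    unfolding Hp Hd by (rule surj_sandwich_iff_inj_dual_sandwich)+
  moreover have "inj Hp \<longleftrightarrow> (\<forall>l\<in>eig F. rank (Rl l) = CARD('n2))"
    unfolding Hp Rl by (rule inj_poly_sandwich_iff)
  moreover have "inj Hd \<longleftrightarrow> (\<forall>l\<in>eig F. rank (Rl l) = CARD('n1))"
    unfolding Hd Rl by (rule inj_poly_dual_sandwich_iff)
  ultimately show ?thesis
    by simp
qed

end
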